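(* For every odd $n\in\mathbb{N}$, $$\sum_{k\in\mathrm{Reg}_n}\tan^2\left(\frac{k\pi}{n}\right)=\varrho_2(n)-\varrho(n),$$ $$\sum_{k\in\mathrm{Reg}_n}\tan^4\left(\frac{k\pi}{n}\right)=\frac13\left(\varrho_4(n)-4\varrho_2(n)+3\varrho(n)\right).$$
   Context: $\mathbb{N}=\{1,2,\ldots\}$. An integer $k$ is called regular (mod $n$) if there exists $x\in\mathbb{Z}$ with $k^2x\equiv k\pmod n$, $\mathrm{Reg}_n=\{k\in\mathbb{N}:1\le k\le n,\ k\text{ is regular (mod }n)\}$, and $\varrho(n)=\#\mathrm{Reg}_n$. $d\,\|\,n$ means that $d$ is a unitary divisor of $n$, i.e. $d\ge1$, $d\mid n$ and $\gcd(d,n/d)=1$. For a real number $s$, $\phi_s(n)=\sum_{d\mid n}d^s\mu(n/d)$ ($\mu$ is the Möbius function) and $\varrho_s(n)=\sum_{d\,\|\,n}\phi_s(d)$; one has $\varrho_1=\varrho$. *)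

theory Defs
  imports "HOL-Number_Theory.Number_Theory" "HOL-Computational_Algebra.Squarefree" "HOL-Analysis.Analysis"
begin

definition regular_mod :: "nat \<Rightarrow> int \<Rightarrow> bool" where
  "regular_mod n k \<longleftrightarrow> (\<exists>x::int. [k^2 * x = k] (mod int n))"

definition Reg :: "nat \<Rightarrow> nat set" where
  "Reg n = {k. 1 \<le> k \<and> k \<le> n \<and> regular_mod n (int k)}"

definition varrho :: "nat \<Rightarrow> nat" where
  "varrho n = card (Reg n)"

definition unitary_divisor :: "nat \<Rightarrow> nat \<Rightarrow> bool" where
  "unitary_divisor d n \<longleftrightarrow> 1 \<le> d \<and> d dvd n \<and> coprime d (n div d)"

definition moebius_mu :: "nat \<Rightarrow> int" where
  "moebius_mu n = (if squarefree n then (- 1) ^ card (prime_factors n) else 0)"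

(* Meaningful for n > 0 only: every natural number divides 0, so the sum over the
   divisors of 0 is 0 by convention. *)
definition phi_s :: "real \<Rightarrow> nat \<Rightarrow> real" where
  "phi_s s n = (\<Sum>d | d dvd n. real d powr s * of_int (moebius_mu (n div d)))"

definition varrho_s :: "real \<Rightarrow> nat \<Rightarrow> real" where
  "varrho_s s n = (\<Sum>d | unitary_divisor d n. phi_s s d)"

end

(* An integer k is regular mod n iff d = n / gcd(k, n) is a unitary divisor of n, so the fractions
   k/n with k in Reg n are the reduced fractions j/d with d a unitary divisor of n. Moebius inversion
   reduces a sum over reduced fractions with denominator d to the complete sums over j = 1, ..., e
   for e dividing d. For the complete sums let w = exp(2 pi i j/n). As n is odd, sec^2(pi j/n) has
   the finite Fourier expansion sum_{m=1..n} (-1)^(m+1) (2m - n) w^m, and pairing it with the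
   constant 1 and with itself (Parseval) gives the sums of sec^2 and sec^4, hence those of tan^2
   and tan^4. *)
theory Submission
  imports Defs
begin

section \<open>The Moebius function and its divisor sums\<close>

lemma moebius_mu_prime_mult:
  assumes "prime p" "\<not> p dvd e"
  shows "moebius_mu (p * e) = - moebius_mu e"
proof -
  have cop: "coprime p e" using assms by (simp add: prime_imp_coprime)
  have "e \<noteq> 0" using assms(2) by (metis dvd_0_right)
  then have "prime_factors (p * e) = insert p (prime_factors e)"
    using assms(1) by (simp add: prime_factors_product prime_prime_factors)
  moreover have "p \<notin> prime_factors e" using assms(2) by auto
  moreover have "squarefree (p * e) \<longleftrightarrow> squarefree e"
    using cop assms(1) by (metis squarefree_mult_coprime squarefree_multD(2) squarefree_prime)
  ultimately show ?thesis by (simp add: moebius_mu_def)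
qed

lemma moebius_mu_eq_0: "\<not> squarefree n \<Longrightarrow> moebius_mu n = 0"
  by (simp add: moebius_mu_def)

text \<open>Only squarefree divisors contribute; for \<open>n > 1\<close>, toggling one fixed prime
  factor of \<open>n\<close> pairs them off with opposite signs.\<close>

lemma sum_moebius_mu_divisors:
  assumes "n > 0"
  shows "(\<Sum>d | d dvd n. moebius_mu d) = (if n = 1 then 1 else 0)"
proof (cases "n = 1")
  case True
  then show ?thesis by (simp add: moebius_mu_def)
next
  case False
  then obtain p where p: "prime p" "p dvd n" by (metis prime_factor_nat)
  have "p > 0" using p(1) by (simp add: prime_gt_0_nat)
  define T where "T = {d. d dvd n \<and> squarefree d}"
  \<comment> \<open>a sign-reversing involution on the squarefree divisors\<close>
  define h where "h d = (if p dvd d then d div p else p * d)" for d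
  have pp: "\<not> p dvd e" if "squarefree (p * e)" for e
    using that p(1) by (metis dvd_refl mult_dvd_mono not_prime_unit power2_eq_square squarefree_def)
  have hT: "h d \<in> T" "h (h d) = d" "moebius_mu (h d) = - moebius_mu d" if d: "d \<in> T" for d
  proof -
    have "h d \<in> T \<and> h (h d) = d \<and> moebius_mu (h d) = - moebius_mu d"
    proof (cases "p dvd d")
      case True
      then obtain e where e: "d = p * e" by auto
      have "\<not> p dvd e" using d e pp by (auto simp: T_def)
      moreover have "e dvd n" "squarefree e"
        using d e by (auto simp: T_def dest: squarefree_multD dvd_mult_right)
      ultimately show ?thesis using e True \<open>p > 0\<close> p moebius_mu_prime_mult[of p e]
        by (simp add: h_def T_def)
    next
      case F: False
      have cop: "coprime p d" using F p(1) by (simp add: prime_imp_coprime)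
      have "p * d dvd n" using d cop p(2) by (auto simp: T_def divides_mult)
      moreover have "squarefree (p * d)"
        using d cop p(1) by (auto simp: T_def squarefree_prime squarefree_mult_coprime)
      ultimately show ?thesis using F \<open>p > 0\<close> p moebius_mu_prime_mult[of p d]
        by (simp add: h_def T_def)
    qed
    then show "h d \<in> T" "h (h d) = d" "moebius_mu (h d) = - moebius_mu d" by auto
  qed
  have "(\<Sum>d\<in>T. moebius_mu d) = (\<Sum>d\<in>T. - moebius_mu d)"
    by (rule sum.reindex_bij_witness[of _ h h]) (use hT in auto)
  then have "(\<Sum>d\<in>T. moebius_mu d) = 0" by (simp add: sum_negf)
  moreover have "(\<Sum>d | d dvd n. moebius_mu d) = (\<Sum>d\<in>T. moebius_mu d)"
    using assms by (intro sum.mono_neutral_right) (auto simp: T_def moebius_mu_eq_0)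
  ultimately show ?thesis using False by simp
qed

section \<open>Moebius inversion for sums over reduced fractions\<close>

lemma div_div_dvd_self: "n > 0 \<Longrightarrow> d dvd n \<Longrightarrow> n div (n div d) = d" for n d :: nat
  by (auto elim!: dvdE)

lemma div_dvd_self: "d dvd n \<Longrightarrow> n div d dvd n" for n d :: nat
  by (metis dvd_div_mult_self dvd_triv_left)

text \<open>Coprimality of \<open>j\<close> and \<open>n\<close> is detected by summing
  \<open>moebius_mu e\<close> over the common divisors \<open>e\<close>. After exchanging the sums,
  the multiples of \<open>e\<close> up to \<open>n\<close> form a complete sum with denominator
  \<open>d = n div e\<close>.\<close>

lemma sum_totatives_moebius_mu:
  fixes f :: "real \<Rightarrow> real"
  assumes "n > 0"
  shows "(\<Sum>j\<in>totatives n. f (real j / real n)) =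
    (\<Sum>d | d dvd n. (\<Sum>j=1..d. f (real j / real d)) * of_int (moebius_mu (n div d)))"
proof -
  have "(\<Sum>j\<in>totatives n. f (real j / real n)) =
      (\<Sum>j=1..n. f (real j / real n) * of_int (if coprime j n then 1 else 0))"
    by (rule sum.mono_neutral_cong_left)
      (auto simp: totatives_def)
  also have "\<dots> = (\<Sum>j=1..n. \<Sum>e | e dvd n \<and> e dvd j. f (real j / real n) * of_int (moebius_mu e))"
  proof (rule sum.cong)
    fix j assume "j \<in> {1..n}"
    then have "gcd j n > 0" by auto
    then have eq: "(if coprime j n then 1 else 0) = (\<Sum>e | e dvd n \<and> e dvd j. moebius_mu e)"
      using sum_moebius_mu_divisors[of "gcd j n"]
      by (simp only: coprime_iff_gcd_eq_1 gcd_greatest_iff conj_commute)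
    show "f (real j / real n) * of_int (if coprime j n then 1 else 0) =
       (\<Sum>e | e dvd n \<and> e dvd j. f (real j / real n) * of_int (moebius_mu e))"
      unfolding eq by (simp add: sum_distrib_left)
  qed simp
  also have "\<dots> = (\<Sum>j\<in>{1..n}. \<Sum>e\<in>{e. e \<in> {e. e dvd n} \<and> e dvd j}. f (real j / real n) * of_int (moebius_mu e))"
    by simp
  also have "\<dots> = (\<Sum>e\<in>{e. e dvd n}. \<Sum>j\<in>{j. j \<in> {1..n} \<and> e dvd j}. f (real j / real n) * of_int (moebius_mu e))"
    using assms by (intro sum.swap_restrict) auto
  also have "\<dots> = (\<Sum>d | d dvd n. \<Sum>j | j \<in> {1..n} \<and> (n div d) dvd j. f (real j / real n) * of_int (moebius_mu (n div d)))"
    by (rule sum.reindex_bij_witness[of _ "\<lambda>d. n div d" "\<lambda>d. n div d"])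
      (use assms in \<open>auto simp: div_div_dvd_self div_dvd_self\<close>)
  also have "\<dots> = (\<Sum>d | d dvd n. (\<Sum>j=1..d. f (real j / real d)) * of_int (moebius_mu (n div d)))"
  proof (rule sum.cong)
    fix d assume "d \<in> {d. d dvd n}"
    then obtain e where e: "n = d * e" by auto
    with assms have pos: "d > 0" "e > 0" by auto
    \<comment> \<open>The multiples of \<open>e\<close> up to \<open>n\<close> are
      \<open>j * e\<close> with \<open>j\<close> in \<open>{1..d}\<close>, and
      \<open>j * e / n = j / d\<close>.\<close>
    have "(\<Sum>j | j \<in> {1..n} \<and> e dvd j. f (real j / real n)) = (\<Sum>j=1..d. f (real j / real d))"
      by (rule sum.reindex_bij_witness[of _ "\<lambda>j. j * e" "\<lambda>j. j div e"])
        (use pos in \<open>auto simp: e mult.commute dvd_def\<close>)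
    then show "(\<Sum>j | j \<in> {1..n} \<and> (n div d) dvd j. f (real j / real n) * of_int (moebius_mu (n div d))) =
       (\<Sum>j=1..d. f (real j / real d)) * of_int (moebius_mu (n div d))"
      using pos e by (simp flip: sum_distrib_right)
  qed simp
  finally show ?thesis .
qed

section \<open>Regular integers and unitary divisors\<close>

text \<open>Write \<open>k = g * j\<close> and \<open>n = g * d\<close> with
  \<open>g = gcd k n\<close>. Cancelling \<open>g\<close>, and then \<open>j\<close>, which is
  coprime to \<open>d\<close>, turns the congruence into \<open>k * x = 1\<close> modulo
  \<open>d\<close>. This is solvable iff \<open>k\<close>, equivalently \<open>g\<close>, is coprime
  to \<open>d\<close>.\<close>

lemma regular_mod_iff:
  assumes "n > 0"
  shows "regular_mod n (int k) \<longleftrightarrow> coprime (gcd k n) (n div gcd k n)"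
proof -
  define g where "g = gcd k n"
  define j d where "j = k div g" and "d = n div g"
  have g: "g > 0" using assms by (simp add: g_def)
  have k: "k = g * j" and n: "n = g * d" by (simp_all add: g_def j_def d_def)
  have jd: "coprime j d" using assms unfolding j_def d_def g_def
    by (intro div_gcd_coprime) auto
  have *: "[int k ^ 2 * x = int k] (mod int n) \<longleftrightarrow> int d dvd int k * x - 1" for x
  proof -
    have "[int k ^ 2 * x = int k] (mod int n) \<longleftrightarrow> int g * int d dvd int g * (int j * (int k * x - 1))"
      unfolding cong_iff_dvd_diff n by (simp add: k power2_eq_square algebra_simps)
    also have "\<dots> \<longleftrightarrow> int d dvd int j * (int k * x - 1)" using g by simp
    also have "\<dots> \<longleftrightarrow> int d dvd int k * x - 1"
      using jd by (simp add: coprime_dvd_mult_right_iff coprime_commute)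
    finally show ?thesis .
  qed
  have "regular_mod n (int k) \<longleftrightarrow> (\<exists>x. [int k * x = 1] (mod int d))"
    unfolding regular_mod_def * by (simp add: cong_iff_dvd_diff)
  also have "\<dots> \<longleftrightarrow> coprime k d" by (simp flip: coprime_iff_invertible_int)
  also have "\<dots> \<longleftrightarrow> coprime g d" using jd by (simp add: k)
  finally show ?thesis by (simp add: g_def d_def)
qed

text \<open>Reduce \<open>k / n\<close> to lowest terms \<open>j / d\<close>: by
  \<open>regular_mod_iff\<close>, \<open>k\<close> is regular exactly when \<open>d\<close> is a
  unitary divisor. The inverse map sends \<open>(d, j)\<close> to
  \<open>j * (n div d)\<close>.\<close>

lemma sum_Reg:
  fixes f :: "real \<Rightarrow> real"
  assumes "n > 0"
  shows "(\<Sum>k\<in>Reg n. f (real k / real n)) =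
    (\<Sum>d | unitary_divisor d n. \<Sum>j\<in>totatives d. f (real j / real d))"
proof -
  have fin: "finite {d. unitary_divisor d n}"
    by (rule finite_subset[of _ "{..n}"]) (use assms in \<open>auto simp: unitary_divisor_def dvd_imp_le\<close>)
  have "(\<Sum>k\<in>Reg n. f (real k / real n)) =
    (\<Sum>(d,j)\<in>Sigma {d. unitary_divisor d n} totatives. f (real j / real d))"
  proof (rule sum.reindex_bij_witness[of _ "\<lambda>(d,j). j * (n div d)" "\<lambda>k. (n div gcd k n, k div gcd k n)"], goal_cases)
    case (1 k)
    show ?case using assms by (simp add: div_div_dvd_self)
  next
    case (2 k)
    then have k: "1 \<le> k" "k \<le> n" "coprime (gcd k n) (n div gcd k n)"
      using assms by (auto simp: Reg_def regular_mod_iff)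
    moreover have "n div (n div gcd k n) = gcd k n"
      using assms by (simp add: div_div_dvd_self)
    moreover have "coprime (k div gcd k n) (n div gcd k n)"
      using assms by (intro div_gcd_coprime) auto
    moreover have "k div gcd k n > 0" "n div gcd k n > 0"
      using k assms by (auto simp: div_greater_zero_iff intro: dvd_imp_le)
    moreover have "n div gcd k n dvd n" by (simp add: div_dvd_self)
    ultimately show ?case
      by (auto simp: unitary_divisor_def totatives_def coprime_commute div_le_mono)
  next
    case (3 x)
    obtain d j where x: "x = (d, j)" by force
    with 3 have d: "unitary_divisor d n" and j: "j \<in> totatives d" by auto
    then obtain e where e: "n = d * e" by (auto simp: unitary_divisor_def)
    with assms have pos: "d > 0" "e > 0" by auto
    \<comment> \<open>As \<open>j\<close> is coprime to \<open>d\<close>, cancelling the gcd of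
      \<open>j * e\<close> and \<open>n\<close> removes exactly \<open>e\<close> and recovers
      \<open>(d, j)\<close>.\<close>
    have "gcd (e * j) (e * d) = e" using j
      unfolding gcd_mult_distrib_nat[symmetric] by (simp add: totatives_def)
    then have "gcd (j * e) n = e" by (simp add: e mult.commute)
    then show ?case using x e pos by simp
  next
    case (4 x)
    obtain d j where x: "x = (d, j)" by force
    with 4 have d: "unitary_divisor d n" and j: "j \<in> totatives d" by auto
    then obtain e where e: "n = d * e" by (auto simp: unitary_divisor_def)
    with assms have pos: "d > 0" "e > 0" by auto
    have "gcd (e * j) (e * d) = e" using j
      unfolding gcd_mult_distrib_nat[symmetric] by (simp add: totatives_def)
    then have "gcd (j * e) n = e" by (simp add: e mult.commute)
    then show ?case using x e pos d j assms
      by (auto simp: Reg_def regular_mod_iff unitary_divisor_def totatives_def coprime_commute)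
  next
    case (5 k)
    have "real (k div gcd k n) / real (n div gcd k n) = real k / real n"
      using assms by (simp add: real_of_nat_div)
    then show ?case by simp
  qed
  also have "\<dots> = (\<Sum>d | unitary_divisor d n. \<Sum>j\<in>totatives d. f (real j / real d))"
    using fin by (subst sum.Sigma) auto
  finally show ?thesis .
qed

section \<open>Finite Fourier expansion of the squared secant\<close>

text \<open>Up to sign, multiplying by \<open>(1 + w)^2\<close> takes second differences of the
  affine sequence \<open>2 * m - a\<close>. These vanish, so only boundary terms at both ends
  survive.\<close>

lemma alternating_affine_geometric_sum:
  fixes w a :: complex
  shows "(\<Sum>m=1..N. (-1) ^ (m+1) * (2 * of_nat m - a) * w ^ m) * (1 + w)\<^sup>2 =
    (2 - a) * w - a * w\<^sup>2 + (-1)^(N+1) * ((2 * of_nat N - a + 2) * w ^ (N+1) + (2 * of_nat N - a) * w ^ (N+2))"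
proof (induction N)
  case 0
  then show ?case by (simp add: algebra_simps power2_eq_square)
next
  case (Suc N)
  then show ?case by (simp add: distrib_right) (simp add: algebra_simps power2_eq_square)
qed

text \<open>Oddness of \<open>n\<close> enters twice: it excludes \<open>w = -1\<close>, where the
  cosine would vanish, and it fixes the sign of the upper boundary terms in the alternating
  sum.\<close>

lemma sec_squared_cis:
  fixes t :: real
  assumes "odd n" and w: "cis (2 * t) ^ n = 1"
  shows "cos t \<noteq> 0"
    and "of_real (1 / (cos t)\<^sup>2) =
      (\<Sum>m=1..n. of_real ((-1) ^ (m+1) * (2 * real m - real n)) * cis (2 * t) ^ m)"
proof -
  define w where "w = cis (2 * t)"
  have wn: "w ^ n = 1" using w by (simp add: w_def)
  have w0: "w \<noteq> 0" by (simp add: w_def)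
  have "1 + w \<noteq> 0"
  proof
    assume "1 + w = 0"
    then have "w = -1" by (simp add: add_eq_0_iff)
    then show False using wn assms(1) by simp
  qed
  moreover have eq: "1 + w = of_real (2 * cos t) * cis t"
    by (auto simp: w_def complex_eq_iff cos_double_cos sin_double power2_eq_square)
  ultimately show c: "cos t \<noteq> 0" by auto
  \<comment> \<open>\<open>sec\<^sup>2 t = 4w / (1 + w)\<^sup>2\<close>\<close>
  have sq: "(1 + w)\<^sup>2 = of_real (4 * (cos t)\<^sup>2) * w"
    unfolding eq by (simp add: power_mult_distrib w_def Complex.DeMoivre)
  \<comment> \<open>With \<open>a = N = n\<close> and \<open>w ^ n = 1\<close> the boundary terms
    are \<open>(2 - n) * w - n * w^2 + (n + 2) * w + n * w^2 = 4 * w\<close>.\<close>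
  have "(\<Sum>m=1..n. of_real ((-1) ^ (m+1) * (2 * real m - real n)) * w ^ m) * (1 + w)\<^sup>2 = 4 * w"
    using alternating_affine_geometric_sum[of "of_nat n" w n] assms(1) wn by (simp add: algebra_simps power2_eq_square)
  then have "(\<Sum>m=1..n. of_real ((-1) ^ (m+1) * (2 * real m - real n)) * w ^ m) * of_real ((cos t)\<^sup>2) = 1"
    unfolding sq using w0 by simp
  then show "of_real (1 / (cos t)\<^sup>2) =
      (\<Sum>m=1..n. of_real ((-1) ^ (m+1) * (2 * real m - real n)) * cis (2 * t) ^ m)"
    using c by (simp add: w_def field_simps)
qed

section \<open>Orthogonality and Parseval for roots of unity\<close>

lemma sum_root_of_unity_powers:
  fixes z :: complex
  assumes "z ^ n = 1"
  shows "(\<Sum>j=1..n. z ^ j) = (if z = 1 then of_nat n else 0)"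
proof (cases "z = 1")
  case False
  have "(\<Sum>j=1..n. z ^ j) = z * (\<Sum>j<n. z ^ j)"
    by (simp add: sum_distrib_left sum.atLeast1_atMost_eq)
  then show ?thesis using False assms by (simp add: geometric_sum)
qed simp

lemma cis_power_orthogonal:
  assumes "m \<in> {1..n}" "l \<in> {1..n}"
  shows "(\<Sum>j=1..n. cis (2 * (real j * pi / real n)) ^ m * cnj (cis (2 * (real j * pi / real n)) ^ l))
    = (if m = l then of_nat n else 0)"
proof -
  have n: "n > 0" using assms by auto
  \<comment> \<open>The summand with index \<open>j\<close> is \<open>z ^ j\<close>, so the sum is a
    geometric one over a root of unity.\<close>
  define z where "z = cis (2 * pi * real m / real n) * cnj (cis (2 * pi * real l / real n))"
  have "(\<Sum>j=1..n. cis (2 * (real j * pi / real n)) ^ m * cnj (cis (2 * (real j * pi / real n)) ^ l)) =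
    (\<Sum>j=1..n. z ^ j)"
    by (intro sum.cong) (auto simp: z_def Complex.DeMoivre power_mult_distrib cis_cnj mult_ac)
  also have "z ^ n = 1" using n
    by (simp add: z_def power_mult_distrib Complex.DeMoivre cis_multiple_2pi flip: complex_cnj_power)
  moreover have "z = 1 \<longleftrightarrow> m = l"
  proof -
    have "z = 1 \<longleftrightarrow> cis (2 * pi * real m / real n) = cis (2 * pi * real l / real n)"
      by (auto simp: z_def cis_cnj cis_mult cis_divide[symmetric] simp flip: cis_inverse divide_inverse)
    also have "\<dots> \<longleftrightarrow> m mod n = l mod n"
      using complex_root_unity_eq[of n m l] n by (simp add: cis_conv_exp mult_ac cong_def)
    \<comment> \<open>The range \<open>{1..n}\<close> is a complete residue system in which
      \<open>n\<close> represents the class of 0, hence the case split.\<close>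
    also have "\<dots> \<longleftrightarrow> m = l" using assms
      by (cases "m = n"; cases "l = n") auto
    finally show ?thesis .
  qed
  ultimately show ?thesis using sum_root_of_unity_powers[of z n] by simp
qed


text \<open>Expand the product and sum over \<open>j\<close> first; orthogonality leaves the
  diagonal \<open>m = l\<close>. The coefficients are real, so conjugation fixes them.\<close>

lemma sum_cis_Parseval:
  fixes b c :: "nat \<Rightarrow> real"
  defines "w \<equiv> \<lambda>n j. cis (2 * (real j * pi / real n))"
  shows "(\<Sum>j=1..n. (\<Sum>m=1..n. of_real (b m) * w n j ^ m) * cnj (\<Sum>l=1..n. of_real (c l) * w n j ^ l))
    = of_real (real n * (\<Sum>m=1..n. b m * c m))"
proof -
  have "(\<Sum>j=1..n. (\<Sum>m=1..n. of_real (b m) * w n j ^ m) * cnj (\<Sum>l=1..n. of_real (c l) * w n j ^ l)) =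
    (\<Sum>j=1..n. \<Sum>m=1..n. \<Sum>l=1..n. of_real (b m * c l) * (w n j ^ m * cnj (w n j ^ l)))"
    by (simp add: sum_product mult_ac)
  also have "\<dots> = (\<Sum>m=1..n. \<Sum>l=1..n. \<Sum>j=1..n. of_real (b m * c l) * (w n j ^ m * cnj (w n j ^ l)))"
    by (subst sum.swap, rule sum.cong[OF refl], subst sum.swap, rule refl)
  also have "\<dots> = (\<Sum>m=1..n. \<Sum>l=1..n. of_real (b m * c l) * (if m = l then of_nat n else 0))"
    by (intro sum.cong refl) (subst sum_distrib_left[symmetric], simp only: w_def cis_power_orthogonal)
  also have "\<dots> = (\<Sum>m=1..n. of_real (b m * c m) * of_nat n)"
    by (simp add: if_distrib[of "\<lambda>x. _ * x"] cong: if_cong)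
  also have "\<dots> = of_real (real n * (\<Sum>m=1..n. b m * c m))"
    by (simp add: sum_distrib_left mult_ac)
  finally show ?thesis .
qed

section \<open>Complete sums of powers of secant and tangent\<close>

lemma sum_affine_squares:
  fixes a :: real
  shows "3 * (\<Sum>m=1..N. (2 * real m - a)\<^sup>2) =
    2 * real N * (real N + 1) * (2 * real N + 1) - 6 * a * real N * (real N + 1) + 3 * a\<^sup>2 * real N"
  by (induction N) (simp_all add: algebra_simps power2_eq_square)

lemma cis_double_angle_root_of_unity:
  assumes "n > 0"
  shows "cis (2 * (real j * pi / real n)) ^ n = 1"
proof -
  have "real n * (2 * (real j * pi / real n)) = 2 * pi * real j" using assms by simp
  then show ?thesis by (simp only: Complex.DeMoivre) (simp add: cis_multiple_2pi)
qed

lemma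
  assumes "odd n"
  shows sum_sec_power_2: "(\<Sum>j=1..n. 1 / (cos (real j * pi / real n))\<^sup>2) = (real n)\<^sup>2"
    and sum_sec_power_4: "3 * (\<Sum>j=1..n. (1 / (cos (real j * pi / real n))\<^sup>2)\<^sup>2) = (real n)\<^sup>2 * ((real n)\<^sup>2 + 2)"
proof -
  have n: "n > 0" using assms by (rule odd_pos)
  define t where "t j = real j * pi / real n" for j
  define c where "c m = (-1) ^ (m+1) * (2 * real m - real n)" for m
  \<comment> \<open>Coefficients of the constant function 1: since \<open>w ^ n = 1\<close>, it is
    carried by the single index \<open>m = n\<close>.\<close>
  define b where "b m = (if m = n then 1 else 0 :: real)" for m
  have root: "cis (2 * t j) ^ n = 1" for j
    unfolding t_def by (rule cis_double_angle_root_of_unity[OF n])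
  have sec: "of_real (1 / (cos (t j))\<^sup>2) = (\<Sum>m=1..n. of_real (c m) * cis (2 * t j) ^ m)" for j
    unfolding c_def by (rule sec_squared_cis(2)[OF assms root])
  have "(\<Sum>m=1..n. of_real (b m) * cis (2 * t j) ^ m) = 1" for j
    using n root by (simp add: b_def if_distrib[of of_real] if_distrib[of "\<lambda>x. x * _"] cong: if_cong)
  then have "complex_of_real (\<Sum>j=1..n. 1 / (cos (t j))\<^sup>2) =
      (\<Sum>j=1..n. (\<Sum>m=1..n. of_real (c m) * cis (2 * t j) ^ m) * cnj (\<Sum>m=1..n. of_real (b m) * cis (2 * t j) ^ m))"
    by (simp only: of_real_sum sec) simp
  also have "\<dots> = of_real (real n * (\<Sum>m=1..n. c m * b m))"
    unfolding t_def by (rule sum_cis_Parseval)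
  \<comment> \<open>Only \<open>c n\<close> survives, and it equals \<open>n\<close> because
    \<open>n + 1\<close> is even.\<close>
  also have "(\<Sum>m=1..n. c m * b m) = real n"
    using n assms by (simp add: b_def c_def if_distrib[of "\<lambda>x. _ * x"] cong: if_cong)
  finally have "(\<Sum>j=1..n. 1 / (cos (t j))\<^sup>2) = real n * real n"
    by (simp only: of_real_eq_iff)
  then show "(\<Sum>j=1..n. 1 / (cos (real j * pi / real n))\<^sup>2) = (real n)\<^sup>2"
    by (simp add: t_def power2_eq_square)
  \<comment> \<open>A real number squared is its product with its own conjugate, so Parseval applies
    with both coefficient sequences equal to \<open>c\<close>.\<close>
  have "complex_of_real (\<Sum>j=1..n. (1 / (cos (t j))\<^sup>2)\<^sup>2) =
      (\<Sum>j=1..n. of_real (1 / (cos (t j))\<^sup>2) * cnj (of_real (1 / (cos (t j))\<^sup>2)))"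
    by (simp add: power2_eq_square)
  also have "\<dots> = of_real (real n * (\<Sum>m=1..n. c m * c m))"
    unfolding sec unfolding t_def by (rule sum_cis_Parseval)
  also have "(\<Sum>m=1..n. c m * c m) = (\<Sum>m=1..n. (2 * real m - real n)\<^sup>2)"
    by (rule sum.cong) (simp_all add: c_def power2_eq_square mult_ac flip: power_mult_distrib)
  finally have "(\<Sum>j=1..n. (1 / (cos (t j))\<^sup>2)\<^sup>2) = real n * (\<Sum>m=1..n. (2 * real m - real n)\<^sup>2)"
    by (simp only: of_real_eq_iff)
  then have "3 * (\<Sum>j=1..n. (1 / (cos (t j))\<^sup>2)\<^sup>2) = real n * (3 * (\<Sum>m=1..n. (2 * real m - real n)\<^sup>2))"
    by simp
  \<comment> \<open>For \<open>a = N = n\<close> the right-hand side of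
    \<open>sum_affine_squares\<close> collapses to \<open>n^3 + 2 * n\<close>.\<close>
  then show "3 * (\<Sum>j=1..n. (1 / (cos (real j * pi / real n))\<^sup>2)\<^sup>2) = (real n)\<^sup>2 * ((real n)\<^sup>2 + 2)"
    unfolding sum_affine_squares by (simp add: t_def algebra_simps power2_eq_square)
qed

lemma
  assumes "odd n"
  shows sum_tan_power_2: "(\<Sum>j=1..n. tan (real j * pi / real n) ^ 2) = real n ^ 2 - real n"
    and sum_tan_power_4: "(\<Sum>j=1..n. tan (real j * pi / real n) ^ 4) =
      (real n ^ 4 - 4 * real n ^ 2 + 3 * real n) / 3"
proof -
  define s where "s j = 1 / (cos (real j * pi / real n))\<^sup>2" for j
  have tan: "tan (real j * pi / real n) ^ 2 = s j - 1" for j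
  proof -
    have "cos (real j * pi / real n) \<noteq> 0"
      using assms by (intro sec_squared_cis(1)[of n] cis_double_angle_root_of_unity odd_pos)
    from tan_sec[OF this] show ?thesis by (simp add: s_def divide_inverse power_inverse)
  qed
  show "(\<Sum>j=1..n. tan (real j * pi / real n) ^ 2) = real n ^ 2 - real n"
    using sum_sec_power_2[OF assms] by (simp add: tan sum_subtractf flip: s_def)
  have "tan (real j * pi / real n) ^ 4 = (s j)\<^sup>2 - 2 * s j + 1" for j
  proof -
    have "tan (real j * pi / real n) ^ 4 = (tan (real j * pi / real n) ^ 2)\<^sup>2" by simp
    then show ?thesis by (simp only: tan) (simp add: power2_eq_square algebra_simps)
  qed
  then have "(\<Sum>j=1..n. tan (real j * pi / real n) ^ 4) = (\<Sum>j=1..n. (s j)\<^sup>2) - 2 * (\<Sum>j=1..n. s j) + real n"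
    by (simp add: sum.distrib sum_subtractf sum_distrib_left)
  then show "(\<Sum>j=1..n. tan (real j * pi / real n) ^ 4) =
      (real n ^ 4 - 4 * real n ^ 2 + 3 * real n) / 3"
    using sum_sec_power_2[OF assms] sum_sec_power_4[OF assms]
    by (simp add: s_def algebra_simps power2_eq_square power4_eq_xxxx)
qed

section \<open>From complete sums to sums over regular integers\<close>

text \<open>Combines the bijection with Moebius inversion. Every denominator \<open>e\<close> that
  occurs satisfies \<open>e dvd d\<close> and \<open>d dvd n\<close>, so the closed form
  \<open>F\<close> is required only at divisors of \<open>n\<close>.\<close>

lemma sum_Reg_eq_of_complete_sums:
  fixes f F :: "real \<Rightarrow> real"
  assumes "n > 0" and "\<And>d. d dvd n \<Longrightarrow> (\<Sum>j=1..d. f (real j / real d)) = F (real d)"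
  shows "(\<Sum>k\<in>Reg n. f (real k / real n)) =
    (\<Sum>d | unitary_divisor d n. \<Sum>e | e dvd d. F (real e) * of_int (moebius_mu (d div e)))"
  unfolding sum_Reg[OF assms(1)]
proof (rule sum.cong[OF refl])
  fix d assume "d \<in> {d. unitary_divisor d n}"
  then have "d dvd n" "d > 0" by (auto simp: unitary_divisor_def)
  then show "(\<Sum>j\<in>totatives d. f (real j / real d)) =
      (\<Sum>e | e dvd d. F (real e) * of_int (moebius_mu (d div e)))"
    unfolding sum_totatives_moebius_mu[OF \<open>d > 0\<close>, of f]
    by (intro sum.cong refl) (use assms(2) \<open>d dvd n\<close> in \<open>auto dest: dvd_trans\<close>)
qed

theorem proposition5p4p2:
  fixes n :: nat
  assumes "odd n"
  shows "(\<Sum>k\<in>Reg n. tan (real k * pi / real n) ^ 2) = varrho_s 2 n - real (varrho n) \<and>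
         (\<Sum>k\<in>Reg n. tan (real k * pi / real n) ^ 4)
           = 1 / 3 * (varrho_s 4 n - 4 * varrho_s 2 n + 3 * real (varrho n))"
proof -
  have n: "n > 0" using assms by (rule odd_pos)
  \<comment> \<open>\<open>M\<close> is linear and maps \<open>x ^ m\<close> to
    \<open>varrho_s m n\<close>, so a polynomial closed form of the complete sums translates
    termwise.\<close>
  define M where "M F = (\<Sum>d | unitary_divisor d n. \<Sum>e | e dvd d. F (real e) * of_int (moebius_mu (d div e)))"
    for F :: "real \<Rightarrow> real"
  have M_add: "M (\<lambda>x. F x + G x) = M F + M G" for F G
    by (simp add: M_def sum.distrib distrib_right)
  have M_mult: "M (\<lambda>x. c * F x) = c * M F" for c F
    by (simp add: M_def sum_distrib_left mult.assoc)
  \<comment> \<open>For \<open>m > 0\<close>, \<open>powr\<close> agrees with the natural power at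
    every nonnegative base, 0 included.\<close>
  have varrho_s: "varrho_s (real m) n = M (\<lambda>x. x ^ m)" if "m > 0" for m
    using that by (simp add: varrho_s_def phi_s_def M_def powr_realpow')
  \<comment> \<open>Counting is the case \<open>f = 1\<close>, whose complete sum with denominator
    \<open>d\<close> is \<open>d\<close>.\<close>
  have varrho: "real (varrho n) = M (\<lambda>x. x)"
    using sum_Reg_eq_of_complete_sums[OF n, of "\<lambda>_. 1" "\<lambda>x. x"] by (simp add: varrho_def M_def)
  have odd: "odd d" if "d dvd n" for d using assms that by (meson dvd_trans)
  \<comment> \<open>The summand is put in the form \<open>f (k / n)\<close>, and the difference is
    written as a sum with factor \<open>-1\<close> to match the linearity rules for
    \<open>M\<close>.\<close>
  have "(\<Sum>k\<in>Reg n. tan (real k / real n * pi) ^ 2) = M (\<lambda>x. x ^ 2 + (-1) * x)"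
    unfolding M_def using sum_tan_power_2[OF odd]
    by (intro sum_Reg_eq_of_complete_sums n) simp
  also have "\<dots> = varrho_s 2 n - real (varrho n)"
    using varrho_s[of 2] unfolding varrho M_add M_mult by simp
  finally have 2: "(\<Sum>k\<in>Reg n. tan (real k * pi / real n) ^ 2) = varrho_s 2 n - real (varrho n)"
    by simp
  have "(\<Sum>k\<in>Reg n. tan (real k / real n * pi) ^ 4) = M (\<lambda>x. 1/3 * (x ^ 4 + ((-4) * x ^ 2 + 3 * x)))"
    unfolding M_def using sum_tan_power_4[OF odd]
    by (intro sum_Reg_eq_of_complete_sums n) simp
  also have "\<dots> = 1 / 3 * (varrho_s 4 n - 4 * varrho_s 2 n + 3 * real (varrho n))"
    using varrho_s[of 2] varrho_s[of 4] unfolding varrho M_add M_mult by simp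
  finally show ?thesis using 2 by simp
qed

end
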